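(* Let $\alpha>0$ and let $\mathbf E=(\mathbf e_S)_{S\in 2^{[m]}}$ be an e-collection. Define, for $R\in 2^{[m]}$, $$\mathrm d_{\mathbf E}(R)=\max\Big\{d\in\{0,1,\dots,m\}:\ \mathbf e_S\ge\frac{\mathbf 1\{|R\setminus S|<d\}}{\alpha}\ \text{ for all }S\in 2^{[m]}\Big\}.$$ Then $\mathrm d_{\mathbf E}$ provides simultaneous true discovery guarantee: $$\mathrm P\big(\mathrm d_{\mathbf E}(R)\le|R\setminus N_{\mathrm P}|\ \text{ for all }R\in 2^{[m]}\big)\ge1-\alpha\quad\text{for all }\mathrm P\in M.$$ Furthermore, if $\mathbf e_S=\boldsymbol\phi_S/\alpha$ for all $S\in 2^{[m]}$, for some family of level $\alpha$ local tests $\boldsymbol\Phi=(\boldsymbol\phi_S)_{S\in 2^{[m]}}$, then $\mathrm d_{\mathbf E}(R)=\mathrm d_{\boldsymbol\Phi}(R)$ for all $R\in 2^{[m]}$, where $\mathrm d_{\boldsymbol\Phi}(R)=\min\{|R\setminus S|:S\in 2^{[m]},\ \boldsymbol\phi_S=0\}$.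
   Context: Setting: $M$ is a set of probability measures on a measurable space; $m\ge 1$, $[m]=\{1,\dots,m\}$; hypotheses $H_1,\dots,H_m\subseteq M$; for $\mathrm P\in M$, $N_{\mathrm P}=\{i\in[m]:\mathrm P\in H_i\}$; $H_S=\bigcap_{i\in S}H_i$. An e-collection is a family $\mathbf E=(\mathbf e_S)_{S\in 2^{[m]}}$ of nonnegative random variables with $\mathbb E_{\mathrm P}(\mathbf e_{N_{\mathrm P}})\le 1$ for all $\mathrm P\in M$, with the convention $\mathbf e_\emptyset=0$. A family of level $\alpha$ local tests is a family of $\{0,1\}$-valued random variables $(\boldsymbol\phi_S)_{S\in 2^{[m]}}$ with $\mathrm P(\boldsymbol\phi_S=1)\le\alpha$ for all $\mathrm P\in H_S$ and nonempty $S\subseteq[m]$, with the convention $\boldsymbol\phi_\emptyset=0$. *)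

theory Defs
  imports "HOL-Probability.Probability"
begin

definition prob_measures_on :: "'a measure \<Rightarrow> 'a measure set \<Rightarrow> bool" where
  "prob_measures_on \<Omega> M \<longleftrightarrow> (\<forall>P\<in>M. prob_space P \<and> sets P = sets \<Omega>)"

definition true_hyps :: "nat \<Rightarrow> (nat \<Rightarrow> 'a measure set) \<Rightarrow> 'a measure \<Rightarrow> nat set" where
  "true_hyps m H P = {i \<in> {1..m}. P \<in> H i}"

definition intersection_hyp :: "(nat \<Rightarrow> 'a measure set) \<Rightarrow> nat set \<Rightarrow> 'a measure set" where
  "intersection_hyp H S = (\<Inter>i\<in>S. H i)"

text \<open>
  Families indexed by the subsets of \<open>{1..m}\<close> are functions on \<^typ>\<open>nat set\<close>; their values
  outside \<open>Pow {1..m}\<close> are unconstrained and never used. Random variables are constrained only on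
  \<open>space \<Omega>\<close>. The expectation of a nonnegative random variable is its Lebesgue integral in
  \<open>[0, \<infinity>]\<close>, so the bound by 1 includes integrability.
\<close>

definition e_collection ::
  "'a measure \<Rightarrow> 'a measure set \<Rightarrow> nat \<Rightarrow> (nat \<Rightarrow> 'a measure set) \<Rightarrow> (nat set \<Rightarrow> 'a \<Rightarrow> real) \<Rightarrow> bool"
where
  "e_collection \<Omega> M m H e \<longleftrightarrow>
     (\<forall>S\<in>Pow {1..m}. e S \<in> borel_measurable \<Omega> \<and> (\<forall>\<omega>\<in>space \<Omega>. 0 \<le> e S \<omega>)) \<and>
     (\<forall>\<omega>\<in>space \<Omega>. e {} \<omega> = 0) \<and>
     (\<forall>P\<in>M. (\<integral>\<^sup>+\<omega>. ennreal (e (true_hyps m H P) \<omega>) \<partial>P) \<le> 1)"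

definition local_tests ::
  "'a measure \<Rightarrow> nat \<Rightarrow> (nat \<Rightarrow> 'a measure set) \<Rightarrow> real \<Rightarrow> (nat set \<Rightarrow> 'a \<Rightarrow> real) \<Rightarrow> bool"
where
  "local_tests \<Omega> m H \<alpha> \<phi> \<longleftrightarrow>
     (\<forall>S\<in>Pow {1..m}. \<phi> S \<in> borel_measurable \<Omega> \<and> (\<forall>\<omega>\<in>space \<Omega>. \<phi> S \<omega> \<in> {0, 1})) \<and>
     (\<forall>\<omega>\<in>space \<Omega>. \<phi> {} \<omega> = 0) \<and>
     (\<forall>S\<in>Pow {1..m}. S \<noteq> {} \<longrightarrow>
        (\<forall>P\<in>intersection_hyp H S. measure P {\<omega>\<in>space P. \<phi> S \<omega> = 1} \<le> \<alpha>))"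

text \<open>
  For an e-collection the set below contains 0, and for a family of local tests the set
  in \<open>d_tests\<close> contains \<^term>\<open>card R\<close>, so \<open>Max\<close> and \<open>Min\<close> are taken over nonempty finite sets.
\<close>

definition d_e :: "nat \<Rightarrow> real \<Rightarrow> (nat set \<Rightarrow> 'a \<Rightarrow> real) \<Rightarrow> nat set \<Rightarrow> 'a \<Rightarrow> nat" where
  "d_e m \<alpha> e R \<omega> =
     Max {d \<in> {0..m}. \<forall>S\<in>Pow {1..m}. e S \<omega> \<ge> of_bool (card (R - S) < d) / \<alpha>}"

definition d_tests :: "nat \<Rightarrow> (nat set \<Rightarrow> 'a \<Rightarrow> real) \<Rightarrow> nat set \<Rightarrow> 'a \<Rightarrow> nat" where
  "d_tests m \<phi> R \<omega> = Min {card (R - S) | S. S \<in> Pow {1..m} \<and> \<phi> S \<omega> = 0}"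

definition simultaneous_true_discovery_guarantee ::
  "'a measure set \<Rightarrow> nat \<Rightarrow> (nat \<Rightarrow> 'a measure set) \<Rightarrow> real \<Rightarrow> (nat set \<Rightarrow> 'a \<Rightarrow> nat) \<Rightarrow> bool"
where
  "simultaneous_true_discovery_guarantee M m H \<alpha> d \<longleftrightarrow>
     (\<forall>P\<in>M. measure P {\<omega>\<in>space P. \<forall>R\<in>Pow {1..m}. d R \<omega> \<le> card (R - true_hyps m H P)} \<ge> 1 - \<alpha>)"

end

(* On the event e_N < 1/alpha, where N is the set of true hypotheses, the constraint for S = N
   excludes every d > card (R - N), simultaneously in R; Markov's inequality bounds the
   probability of the complement by alpha. *)
theory Submission
  imports Defs
begin

text \<open>Nonnegativity makes d = 0 admissible, so \<open>Max\<close> ranges over a nonempty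
  finite set and is bounded by k iff every admissible d is. The right-hand side is a finite Boolean
  combination of inequalities on the values \<open>e S \<omega>\<close>, the form in which
  measurability can be read off.\<close>

lemma d_e_le_iff:
  assumes "\<forall>S\<in>Pow {1..m}. 0 \<le> e S \<omega>"
  shows "d_e m \<alpha> e R \<omega> \<le> k \<longleftrightarrow>
    (\<forall>d\<in>{0..m}. (\<forall>S\<in>Pow {1..m}. of_bool (card (R - S) < d) / \<alpha> \<le> e S \<omega>) \<longrightarrow> d \<le> k)"
proof -
  let ?D = "{d \<in> {0..m}. \<forall>S\<in>Pow {1..m}. of_bool (card (R - S) < d) / \<alpha> \<le> e S \<omega>}"
  have "0 \<in> ?D"
    using assms by auto
  then have "Max ?D \<le> k \<longleftrightarrow> (\<forall>d\<in>?D. d \<le> k)"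
    by (subst Max_le_iff) auto
  then show ?thesis
    unfolding d_e_def by blast
qed

lemma d_e_le_card_diff:
  assumes "\<forall>S\<in>Pow {1..m}. 0 \<le> e S \<omega>" and "N \<in> Pow {1..m}" and "e N \<omega> < 1 / \<alpha>"
  shows "d_e m \<alpha> e R \<omega> \<le> card (R - N)"
  unfolding d_e_le_iff[of m e, OF assms(1)]
proof (intro ballI impI)
  fix d
  assume "\<forall>S\<in>Pow {1..m}. of_bool (card (R - S) < d) / \<alpha> \<le> e S \<omega>"
  then have "of_bool (card (R - N) < d) / \<alpha> \<le> e N \<omega>"
    using assms(2) by blast
  \<comment> \<open>If \<open>card (R - N) < d\<close>, the constraint becomes
    \<open>1 / \<alpha> \<le> e N \<omega>\<close>, against the assumption on
    \<open>e N \<omega>\<close>.\<close>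
  then show "d \<le> card (R - N)"
    using assms(3) by (cases "card (R - N) < d") auto
qed

text \<open>Markov's inequality at the threshold 1/\<alpha>, read on the complementary event.
  \<open>ennreal\<close> sends negative values of f to 0; this leaves the event
  \<open>1 / \<alpha> \<le> f \<omega>\<close> unchanged, as 1/\<alpha> is positive.\<close>

lemma (in prob_space) prob_less_inverse_ge:
  fixes f :: "'a \<Rightarrow> real"
  assumes [measurable]: "f \<in> borel_measurable M"
    and "(\<integral>\<^sup>+\<omega>. ennreal (f \<omega>) \<partial>M) \<le> 1" and "\<alpha> > 0"
  shows "1 - \<alpha> \<le> prob {\<omega>\<in>space M. f \<omega> < 1 / \<alpha>}"
proof -
  \<comment> \<open>The cited Markov inequality bounds events of the form
    \<open>1 \<le> c * u \<omega>\<close>; here c = \<alpha>.\<close>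
  have "{\<omega>\<in>space M. 1 / \<alpha> \<le> f \<omega>} \<subseteq> {\<omega>\<in>space M. 1 \<le> ennreal \<alpha> * ennreal (f \<omega>)}"
  proof safe
    fix \<omega> assume "1 / \<alpha> \<le> f \<omega>"
    then have "1 \<le> \<alpha> * f \<omega>"
      using \<open>\<alpha> > 0\<close> by (simp add: field_simps)
    then have "1 \<le> ennreal (\<alpha> * f \<omega>)"
      by (simp add: ennreal_ge_1)
    then show "1 \<le> ennreal \<alpha> * ennreal (f \<omega>)"
      using \<open>\<alpha> > 0\<close> by (simp add: ennreal_mult')
  qed
  then have "emeasure M {\<omega>\<in>space M. 1 / \<alpha> \<le> f \<omega>}
      \<le> emeasure M {\<omega>\<in>space M. 1 \<le> ennreal \<alpha> * ennreal (f \<omega>)}"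
    by (intro emeasure_mono) auto
  also have "\<dots> \<le> ennreal \<alpha> * (\<integral>\<^sup>+\<omega>. ennreal (f \<omega>) * indicator (space M) \<omega> \<partial>M)"
    using nn_integral_Markov_inequality[of "\<lambda>\<omega>. ennreal (f \<omega>)" "space M" M "ennreal \<alpha>"] by simp
  also have "\<dots> = ennreal \<alpha> * (\<integral>\<^sup>+\<omega>. ennreal (f \<omega>) \<partial>M)"
    by (intro arg_cong2[where f="(*)"] nn_integral_cong) auto
  also have "\<dots> \<le> ennreal \<alpha> * 1"
    by (intro mult_left_mono assms) simp
  finally have "prob {\<omega>\<in>space M. 1 / \<alpha> \<le> f \<omega>} \<le> \<alpha>"
    using \<open>\<alpha> > 0\<close> by (simp add: emeasure_eq_measure)
  moreover have "prob {\<omega>\<in>space M. \<not> 1 / \<alpha> \<le> f \<omega>} = 1 - prob {\<omega>\<in>space M. 1 / \<alpha> \<le> f \<omega>}"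
    by (rule prob_neg) measurable
  ultimately show ?thesis
    by (simp add: not_le)
qed

lemma e_collection_true_discovery_guarantee:
  assumes "prob_measures_on \<Omega> M" and "\<alpha> > 0" and "e_collection \<Omega> M m H e"
  shows "simultaneous_true_discovery_guarantee M m H \<alpha> (d_e m \<alpha> e)"
  unfolding simultaneous_true_discovery_guarantee_def
proof
  fix P assume "P \<in> M"
  then interpret prob_space P
    using assms(1) by (simp add: prob_measures_on_def)
  have sets_P: "sets P = sets \<Omega>"
    using assms(1) \<open>P \<in> M\<close> by (simp add: prob_measures_on_def)
  have meas [measurable]: "e S \<in> borel_measurable P" if "S \<in> Pow {1..m}" for S
    using assms(3) that measurable_cong_sets[OF sets_P refl]
    by (auto simp: e_collection_def)
  have nonneg: "\<forall>S\<in>Pow {1..m}. 0 \<le> e S \<omega>" if "\<omega> \<in> space P" for \<omega>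
    using assms(3) that sets_eq_imp_space_eq[OF sets_P] by (auto simp: e_collection_def)
  define N where "N = true_hyps m H P"
  have N: "N \<in> Pow {1..m}"
    by (auto simp: N_def true_hyps_def)
  let ?A = "{\<omega>\<in>space P. \<forall>R\<in>Pow {1..m}. d_e m \<alpha> e R \<omega> \<le> card (R - N)}"
  \<comment> \<open>Monotonicity of the measure requires the larger set \<open>?A\<close> to be an
    event. With \<open>Max\<close> eliminated, it is built by finite quantifiers and implications
    from the measurable sets where \<open>e S\<close> is at least a constant.\<close>
  have "?A = {\<omega>\<in>space P. \<forall>R\<in>Pow {1..m}. \<forall>d\<in>{0..m}.
      (\<forall>S\<in>Pow {1..m}. of_bool (card (R - S) < d) / \<alpha> \<le> e S \<omega>) \<longrightarrow> d \<le> card (R - N)}"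
    using d_e_le_iff[of m e, OF nonneg] by auto
  also have "\<dots> \<in> events"
    by (intro sets.sets_Collect_finite_All sets.sets_Collect_imp sets.sets_Collect_const
        borel_measurable_le borel_measurable_const meas finite_Pow_iff[THEN iffD2]
        finite_atLeastAtMost)
  finally have "?A \<in> events" .
  moreover have "{\<omega>\<in>space P. e N \<omega> < 1 / \<alpha>} \<subseteq> ?A"
    using d_e_le_card_diff[of m e _ N \<alpha>, OF nonneg N] by auto
  ultimately have "prob {\<omega>\<in>space P. e N \<omega> < 1 / \<alpha>} \<le> prob ?A"
    by (intro finite_measure_mono)
  moreover have "1 - \<alpha> \<le> prob {\<omega>\<in>space P. e N \<omega> < 1 / \<alpha>}"
    using assms(3) \<open>P \<in> M\<close> \<open>\<alpha> > 0\<close>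
    by (intro prob_less_inverse_ge meas[OF N]) (auto simp: e_collection_def N_def)
  ultimately show "1 - \<alpha> \<le> prob {\<omega>\<in>space P. \<forall>R\<in>Pow {1..m}.
      d_e m \<alpha> e R \<omega> \<le> card (R - true_hyps m H P)}"
    by (simp add: N_def)
qed

text \<open>At a set S with \<open>\<phi> S \<omega> = 1\<close> the constraint on d is vacuous,
  since \<open>e S \<omega>\<close> equals 1/\<alpha>; at \<open>\<phi> S \<omega> = 0\<close> it
  says \<open>d \<le> card (R - S)\<close>. The admissible d therefore form an initial segment of
  the naturals, whose largest element is the minimum defining \<open>d_tests\<close>.\<close>

lemma d_e_eq_d_tests:
  assumes "\<alpha> > 0" and "R \<in> Pow {1..m}" and "\<phi> {} \<omega> = 0"
    and "\<And>S. S \<in> Pow {1..m} \<Longrightarrow> \<phi> S \<omega> \<in> {0, 1}"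
    and "\<And>S. S \<in> Pow {1..m} \<Longrightarrow> e S \<omega> = \<phi> S \<omega> / \<alpha>"
  shows "d_e m \<alpha> e R \<omega> = d_tests m \<phi> R \<omega>"
proof -
  let ?T = "{card (R - S) | S. S \<in> Pow {1..m} \<and> \<phi> S \<omega> = 0}"
  have fin: "finite ?T"
    by simp
  \<comment> \<open>The convention \<open>\<phi> {} \<omega> = 0\<close> lets S = {} contribute
    \<open>card R\<close>. This makes \<open>?T\<close> nonempty and gives
    \<open>Min ?T \<le> m\<close>, so the cap d \<le> m in \<open>d_e\<close> does not cut the
    segment short.\<close>
  have mem: "card R \<in> ?T"
    using assms(3) by (auto intro!: exI[of _ "{}"])
  have "card R \<le> m"
    using assms(2) card_mono[of "{1..m}" R] by simp
  then have "Min ?T \<le> m"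
    using Min_le[OF fin mem] by linarith
  moreover have "(of_bool (card (R - S) < d) / \<alpha> \<le> e S \<omega>) \<longleftrightarrow> (\<phi> S \<omega> = 0 \<longrightarrow> d \<le> card (R - S))"
    if "S \<in> Pow {1..m}" for S d
    using assms(4,5)[OF that] \<open>\<alpha> > 0\<close> by (auto simp: divide_simps)
  then have "(\<forall>S\<in>Pow {1..m}. of_bool (card (R - S) < d) / \<alpha> \<le> e S \<omega>) \<longleftrightarrow> d \<le> Min ?T" for d
    using mem by (subst Min_ge_iff[OF fin]) (blast, simp, blast)
  ultimately have "{d \<in> {0..m}. \<forall>S\<in>Pow {1..m}. of_bool (card (R - S) < d) / \<alpha> \<le> e S \<omega>}
      = {0..Min ?T}"
    by auto
  then show ?thesis
    by (simp only: d_e_def d_tests_def) (rule Max_eqI, auto)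
qed

theorem theorem44:
  fixes \<Omega> :: "'a measure"
    and M :: "'a measure set"
    and m :: nat
    and H :: "nat \<Rightarrow> 'a measure set"
    and \<alpha> :: real
    and e :: "nat set \<Rightarrow> 'a \<Rightarrow> real"
  assumes "prob_measures_on \<Omega> M"
    and "m \<ge> 1"
    and "\<forall>i\<in>{1..m}. H i \<subseteq> M"
    and "\<alpha> > 0"
    and "e_collection \<Omega> M m H e"
  shows "simultaneous_true_discovery_guarantee M m H \<alpha> (d_e m \<alpha> e) \<and>
    (\<forall>\<phi>. local_tests \<Omega> m H \<alpha> \<phi> \<and>
          (\<forall>S\<in>Pow {1..m}. \<forall>\<omega>\<in>space \<Omega>. e S \<omega> = \<phi> S \<omega> / \<alpha>) \<longrightarrow>
          (\<forall>R\<in>Pow {1..m}. \<forall>\<omega>\<in>space \<Omega>. d_e m \<alpha> e R \<omega> = d_tests m \<phi> R \<omega>))"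
proof (intro conjI allI impI ballI)
  show "simultaneous_true_discovery_guarantee M m H \<alpha> (d_e m \<alpha> e)"
    using assms by (intro e_collection_true_discovery_guarantee)
next
  fix \<phi> R \<omega>
  assume "local_tests \<Omega> m H \<alpha> \<phi> \<and> (\<forall>S\<in>Pow {1..m}. \<forall>\<omega>\<in>space \<Omega>. e S \<omega> = \<phi> S \<omega> / \<alpha>)"
    and "R \<in> Pow {1..m}" and "\<omega> \<in> space \<Omega>"
  then show "d_e m \<alpha> e R \<omega> = d_tests m \<phi> R \<omega>"
    using \<open>\<alpha> > 0\<close> unfolding local_tests_def by (intro d_e_eq_d_tests) blast+
qed

end
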